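(* Let $f:\mathbb{R}^n\times\mathbb{R}^m\to\mathbb{R}^n$ be smooth, consider the nonlinear system $x(k+1)=f(x(k),u(k))$, and let $(\overline x,\overline u)$ be an equilibrium pair, i.e. $\overline x=f(\overline x,\overline u)$. Let $u_d(0),\dots,u_d(T-1)$ and $x_d(0),\dots,x_d(T)$ be data with $x_d(k+1)=f(x_d(k),u_d(k))$ for $k=0,\dots,T-1$, and let $X_{0,T},X_{1,T},U_{0,1,T},D_{0,T}$ be the matrices defined in the context. Suppose that: (1) the matrices $\begin{bmatrix}U_{0,1,T}\\ X_{0,T}\end{bmatrix}$ and $X_{1,T}$ have full row rank; (2) $D_{0,T}D_{0,T}^\top\preceq\gamma\,X_{1,T}X_{1,T}^\top$ for some $\gamma>0$. Then any solution $(Q,\alpha)$, $Q\in\mathbb{R}^{T\times n}$, $\alpha>0$, to $$\begin{bmatrix}X_{0,T}Q-\alpha X_{1,T}X_{1,T}^\top & X_{1,T}Q\\ Q^\top X_{1,T}^\top & X_{0,T}Q\end{bmatrix}\succ0,\qquad \begin{bmatrix}I_T& Q\\ Q^\top& X_{0,T}Q\end{bmatrix}\succ0$$ such that $\gamma<\alpha^2/(4+2\alpha)$ returns a stabilizing state-feedback gain $K=U_{0,1,T}\,Q\,(X_{0,T}Q)^{-1}$ (i.e. $A+BK$ is stable, with $A,B$ the linearization matrices), which locally stabilizes the equilibrium pair $(\overline x,\overline u)$.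
   Context: Linearization: $A=\frac{\partial f}{\partial x}\big|_{(\overline x,\overline u)}$, $B=\frac{\partial f}{\partial u}\big|_{(\overline x,\overline u)}$. Deviations: $\delta x_d(k)=x_d(k)-\overline x$, $\delta u_d(k)=u_d(k)-\overline u$, and remainder $d_d(k)=\delta x_d(k+1)-A\,\delta x_d(k)-B\,\delta u_d(k)$ for $k=0,\dots,T-1$. Matrices: $X_{0,T}=[\delta x_d(0)\ \cdots\ \delta x_d(T-1)]$, $X_{1,T}=[\delta x_d(1)\ \cdots\ \delta x_d(T)]$, $U_{0,1,T}=[\delta u_d(0)\ \cdots\ \delta u_d(T-1)]$, $D_{0,T}=[d_d(0)\ \cdots\ d_d(T-1)]$. $M\succ0$ means $M$ is symmetric and positive definite; $M\preceq N$ means $N-M$ is symmetric positive semidefinite. A square matrix is stable if all its eigenvalues have modulus strictly less than $1$. "$K$ locally stabilizes $(\overline x,\overline u)$" means that $\overline x$ is a locally exponentially stable equilibrium of the closed-loop system $x(k+1)=f\big(x(k),\overline u+K(x(k)-\overline x)\big)$. *)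

theory Defs
  imports "HOL-Analysis.Analysis"
begin

(* On a finite-dimensional domain this is class C^k: continuity of x \<mapsto> Df(x) v for every
   direction v is the same as continuity of x \<mapsto> Df(x). *)
primrec cont_differentiable ::
    "nat \<Rightarrow> ('a::euclidean_space \<Rightarrow> 'b::euclidean_space) \<Rightarrow> bool" where
  "cont_differentiable 0 f \<longleftrightarrow> continuous_on UNIV f"
| "cont_differentiable (Suc k) f \<longleftrightarrow>
     (\<forall>x. f differentiable (at x)) \<and>
     (\<forall>v. cont_differentiable k (\<lambda>x. frechet_derivative f (at x) v))"

definition smooth :: "('a::euclidean_space \<Rightarrow> 'b::euclidean_space) \<Rightarrow> bool" where
  "smooth f \<longleftrightarrow> (\<forall>k. cont_differentiable k f)"

definition pos_def :: "real^'n^'n \<Rightarrow> bool" where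
  "pos_def M \<longleftrightarrow> transpose M = M \<and> (\<forall>x. x \<noteq> 0 \<longrightarrow> x \<bullet> (M *v x) > 0)"

definition pos_semidef :: "real^'n^'n \<Rightarrow> bool" where
  "pos_semidef M \<longleftrightarrow> transpose M = M \<and> (\<forall>x. x \<bullet> (M *v x) \<ge> 0)"

definition loewner_le :: "real^'n^'n \<Rightarrow> real^'n^'n \<Rightarrow> bool" where
  "loewner_le M N \<longleftrightarrow> pos_semidef (N - M)"

definition full_row_rank :: "real^'c^'r \<Rightarrow> bool" where
  "full_row_rank M \<longleftrightarrow> rank M = CARD('r)"

definition vstack :: "'a^'c^'r \<Rightarrow> 'a^'c^'s \<Rightarrow> 'a^'c^('r + 's)" where
  "vstack M N = (\<chi> i. case i of Inl r \<Rightarrow> M $ r | Inr s \<Rightarrow> N $ s)"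

definition hstack :: "'a^'c^'r \<Rightarrow> 'a^'d^'r \<Rightarrow> 'a^('c + 'd)^'r" where
  "hstack M N = (\<chi> i j. case j of Inl c \<Rightarrow> M $ i $ c | Inr d \<Rightarrow> N $ i $ d)"

definition block_mat ::
    "'a^'c^'r \<Rightarrow> 'a^'d^'r \<Rightarrow> 'a^'c^'s \<Rightarrow> 'a^'d^'s \<Rightarrow> 'a^('c + 'd)^('r + 's)" where
  "block_mat M11 M12 M21 M22 = vstack (hstack M11 M12) (hstack M21 M22)"

(* The columns of the data matrices are indexed by a finite linearly ordered type 't with
   CARD('t) = T; time_index enumerates it increasingly as 0, ..., T - 1. *)
definition time_index :: "'t::{finite,linorder} \<Rightarrow> nat" where
  "time_index j = card {..<j}"

(* The matrix [v(s), v(s + 1), ..., v(s + T - 1)]. *)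
definition data_matrix :: "nat \<Rightarrow> (nat \<Rightarrow> real^'p) \<Rightarrow> real^('t::{finite,linorder})^'p" where
  "data_matrix s v = (\<chi> i j. v (s + time_index j) $ i)"

(* Eigenvalues are taken over the complex numbers. *)
definition schur_stable :: "real^'n^'n \<Rightarrow> bool" where
  "schur_stable M \<longleftrightarrow>
     (\<forall>(l::complex) (v::complex^'n).
        v \<noteq> 0 \<and> (\<chi> i j. complex_of_real (M $ i $ j)) *v v = l *s v \<longrightarrow> cmod l < 1)"

definition locally_exp_stable_equilibrium ::
    "('a::real_normed_vector \<Rightarrow> 'a) \<Rightarrow> 'a \<Rightarrow> bool" where
  "locally_exp_stable_equilibrium g x0 \<longleftrightarrow>
     g x0 = x0 \<and>
     (\<exists>r>0. \<exists>c>0. \<exists>\<rho>. 0 < \<rho> \<and> \<rho> < 1 \<and>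
        (\<forall>x. norm (x - x0) < r \<longrightarrow>
           (\<forall>k. norm ((g ^^ k) x - x0) \<le> c * \<rho> ^ k * norm (x - x0))))"

definition locally_stabilizes ::
    "((real^'n) \<times> (real^'m) \<Rightarrow> real^'n) \<Rightarrow> real^'n \<Rightarrow> real^'m \<Rightarrow> real^'n^'m \<Rightarrow> bool" where
  "locally_stabilizes f x0 u0 K \<longleftrightarrow>
     locally_exp_stable_equilibrium (\<lambda>x. f (x, u0 + K *v (x - x0))) x0"

end

theory Submission
  imports Defs
begin

text \<open>Write \<open>P = X0 Q\<close>, \<open>W = Q P\<^sup>-\<^sup>1 Q\<^sup>T\<close> and \<open>M = A + B K\<close>. Since \<open>X1 - D0 = A X0 + B U0\<close>, the gain gives
  \<open>M = (X1 - D0) Q P\<^sup>-\<^sup>1\<close>, hence \<open>M P M\<^sup>T = (X1 - D0) W (X1 - D0)\<^sup>T\<close>. The Schur complements of the two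
  matrix inequalities say \<open>X1 W X1\<^sup>T + \<alpha> X1 X1\<^sup>T \<prec> P\<close> and \<open>W \<prec> I\<close>. Expanding the product, Young's
  inequality absorbs all terms in \<open>D0\<close> into \<open>\<alpha> X1 X1\<^sup>T\<close>, so \<open>M P M\<^sup>T \<prec> P\<close>. By duality
  \<open>x \<mapsto> x\<^sup>T P\<^sup>-\<^sup>1 x\<close> decreases strictly along \<open>M\<close>; it bounds the eigenvalues of \<open>M\<close>, and it is a
  quadratic Lyapunov function near the equilibrium for the closed loop, whose derivative there is
  \<open>M\<close>.\<close>

declare transpose_matrix_vector [simp del]

section \<open>Block matrices and positive definiteness\<close>

text \<open>Used with two choices of stacked vector: \<open>x = 0\<close> isolates the lower right
  block, and \<open>y\<close> as a suitable linear function of \<open>x\<close> completes the square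
  in the Schur complement.\<close>

lemma inner_block_mat:
  fixes M11 :: "real^'c^'c" and M12 :: "real^'d^'c" and M21 :: "real^'c^'d" and M22 :: "real^'d^'d"
  fixes x :: "real^'c" and y :: "real^'d"
  defines "z \<equiv> (\<chi> i. case i of Inl a \<Rightarrow> x $ a | Inr b \<Rightarrow> y $ b)"
  shows "z \<bullet> (block_mat M11 M12 M21 M22 *v z) =
    x \<bullet> (M11 *v x) + x \<bullet> (M12 *v y) + y \<bullet> (M21 *v x) + y \<bullet> (M22 *v y)"
  unfolding z_def block_mat_def vstack_def hstack_def inner_vec_def matrix_vector_mult_def
  by (simp add: UNIV_Plus_UNIV[symmetric] sum.Plus distrib_left sum.distrib del: UNIV_Plus_UNIV)

lemma pos_def_block_lower_right:
  fixes M :: "real^'c^'c" and P :: "real^'d^'d"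
  assumes "pos_def (block_mat M N L P)"
  shows "pos_def P"
  unfolding pos_def_def
proof (intro conjI allI impI)
  show "transpose P = P"
  proof (unfold vec_eq_iff, intro allI)
    fix i j
    have "transpose (block_mat M N L P) $ Inr i $ Inr j = block_mat M N L P $ Inr i $ Inr j"
      using assms by (simp add: pos_def_def)
    then show "transpose P $ i $ j = P $ i $ j"
      by (simp add: transpose_def block_mat_def vstack_def hstack_def)
  qed
next
  fix y :: "real^'d" assume "y \<noteq> 0"
  define z where "z = (\<chi> i. case i of Inl a \<Rightarrow> (0::real^'c) $ a | Inr b \<Rightarrow> y $ b)"
  from \<open>y \<noteq> 0\<close> obtain b where "y $ b \<noteq> 0" by (auto simp: vec_eq_iff)
  then have "z $ Inr b \<noteq> 0" by (simp add: z_def)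
  then have "z \<noteq> 0" by (metis zero_index)
  then have "z \<bullet> (block_mat M N L P *v z) > 0" using assms by (simp add: pos_def_def)
  then show "y \<bullet> (P *v y) > 0"
    unfolding z_def inner_block_mat by simp
qed

lemma pos_def_invertible:
  assumes "pos_def P"
  shows "invertible P"
proof -
  have "x = 0" if "P *v x = 0" for x
    using assms that unfolding pos_def_def by (metis inner_zero_right less_irrefl)
  then show ?thesis
    using matrix_left_invertible_ker invertible_left_inverse by blast
qed

lemma matrix_inv_left_right:
  fixes P :: "real^'n^'n"
  assumes "invertible P"
  shows "matrix_inv P ** P = mat 1" and "P ** matrix_inv P = mat 1"
proof -
  have "\<exists>R. P ** R = mat 1 \<and> R ** P = mat 1" using assms by (simp add: invertible_def)
  then have "P ** matrix_inv P = mat 1 \<and> matrix_inv P ** P = mat 1"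
    unfolding matrix_inv_def by (rule someI_ex)
  then show "matrix_inv P ** P = mat 1" "P ** matrix_inv P = mat 1" by auto
qed

lemma transpose_diff:
  fixes M N :: "'a::group_add^'n^'m"
  shows "transpose (M - N) = transpose M - transpose N"
  by (simp add: transpose_def vec_eq_iff)

lemma matrix_add_rdistrib:
  fixes A B :: "'a::semiring_1^'n^'m"
  shows "(A + B) ** C = A ** C + B ** C"
  by (simp add: matrix_matrix_mult_def vec_eq_iff distrib_right sum.distrib)

lemma matrix_inv_mult_vec:
  fixes P :: "real^'n^'n"
  assumes "invertible P"
  shows "P *v (matrix_inv P *v x) = x" and "matrix_inv P *v (P *v x) = x"
  using matrix_inv_left_right[OF assms] by (simp_all add: matrix_vector_mul_assoc)

lemma symmetric_inner:
  fixes P :: "real^'n^'n"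
  assumes "transpose P = P"
  shows "x \<bullet> (P *v y) = y \<bullet> (P *v x)"
  by (metis assms dot_lmul_matrix inner_commute transpose_matrix_vector)

text \<open>The proofs below move matrices across inner products in the form
  \<open>transpose P *v x\<close>; removing \<open>transpose_matrix_vector\<close> from the simp set
  keeps this form from being rewritten to \<open>x v* P\<close>.\<close>

lemma transpose_inner:
  fixes P :: "real^'n^'m"
  shows "x \<bullet> (P *v y) = (transpose P *v x) \<bullet> y"
  by (metis dot_lmul_matrix transpose_matrix_vector)

lemma pos_def_nonneg:
  assumes "pos_def P"
  shows "x \<bullet> (P *v x) \<ge> 0"
  using assms unfolding pos_def_def by (cases "x = 0") (auto intro: less_imp_le)

text \<open>The substitution \<open>x = P *v y\<close> turns the form of the inverse into the form
  of \<open>P\<close> at \<open>y\<close>. Symmetry holds because the transposed inverse is again a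
  right inverse of the symmetric \<open>P\<close>.\<close>

lemma pos_def_matrix_inv:
  assumes P: "pos_def P"
  shows "pos_def (matrix_inv P)"
proof -
  note inv = pos_def_invertible[OF P]
  have sym: "transpose P = P" using P by (simp add: pos_def_def)
  have "x \<bullet> (matrix_inv P *v x) > 0" if "x \<noteq> 0" for x
  proof -
    have "matrix_inv P *v x \<noteq> 0"
      using that matrix_inv_mult_vec(1)[OF inv, of x] by auto
    then have "(matrix_inv P *v x) \<bullet> (P *v (matrix_inv P *v x)) > 0"
      using P by (simp add: pos_def_def)
    then show ?thesis by (simp add: matrix_inv_mult_vec(1)[OF inv] inner_commute)
  qed
  moreover have "transpose (matrix_inv P) = matrix_inv P"
  proof -
    have "P ** transpose (matrix_inv P) = mat 1"
      by (metis inv matrix_inv_left_right(1) matrix_transpose_mul sym transpose_mat)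
    then have "matrix_inv P ** (P ** transpose (matrix_inv P)) = matrix_inv P" by simp
    then show ?thesis by (simp add: matrix_mul_assoc matrix_inv_left_right(1)[OF inv])
  qed
  ultimately show ?thesis by (simp add: pos_def_def)
qed

section \<open>Schur complements and Lyapunov duality\<close>

lemma pos_def_schur_complement:
  assumes block: "pos_def (block_mat M N (transpose N) P)" and "x \<noteq> 0"
  shows "(transpose N *v x) \<bullet> (matrix_inv P *v (transpose N *v x)) < x \<bullet> (M *v x)"
proof -
  have P: "pos_def P" using pos_def_block_lower_right[OF block] .
  define w where "w = transpose N *v x"
  \<comment> \<open>For fixed \<open>x\<close> this is the minimiser of the block form over the
    lower component; there the two mixed terms and the \<open>P\<close> term add up to
    \<open>w \<bullet> y\<close>.\<close>
  define y where "y = - (matrix_inv P *v w)"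
  define z where "z = (\<chi> i. case i of Inl a \<Rightarrow> x $ a | Inr b \<Rightarrow> y $ b)"
  from \<open>x \<noteq> 0\<close> obtain a where "x $ a \<noteq> 0" by (auto simp: vec_eq_iff)
  then have "z $ Inl a \<noteq> 0" by (simp add: z_def)
  then have "z \<noteq> 0" by (metis zero_index)
  then have "z \<bullet> (block_mat M N (transpose N) P *v z) > 0"
    using block by (simp add: pos_def_def)
  moreover have "P *v y = - w"
    by (simp add: y_def vec.neg matrix_inv_mult_vec(1)[OF pos_def_invertible[OF P]])
  moreover have "x \<bullet> (N *v y) = w \<bullet> y" by (simp add: transpose_inner w_def)
  ultimately have "x \<bullet> (M *v x) + w \<bullet> y > 0"
    unfolding z_def inner_block_mat by (simp add: w_def[symmetric] inner_commute)
  then show ?thesis by (simp add: w_def y_def)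
qed

text \<open>Passes from \<open>M ** P ** transpose M\<close> below \<open>P\<close> to
  \<open>transpose M ** matrix_inv P ** M\<close> below \<open>matrix_inv P\<close> without a square
  root of \<open>P\<close>. With \<open>y\<close>, \<open>w\<close>, \<open>u\<close> as in the
  proof and q(z) for the form of \<open>P\<close>, q(w) is the \<open>P\<close>-inner product of
  \<open>u\<close> and \<open>y\<close>, hence at most (q(u) + q(y)) / 2, while q(u) < q(w) by
  \<open>decr\<close>. So q(w) < q(y), which is the claim.\<close>

lemma lyapunov_dual:
  fixes P M :: "real^'n^'n"
  assumes P: "pos_def P"
    and decr: "\<And>v. v \<noteq> 0 \<Longrightarrow> (transpose M *v v) \<bullet> (P *v (transpose M *v v)) < v \<bullet> (P *v v)"
    and "x \<noteq> 0"
  shows "(M *v x) \<bullet> (matrix_inv P *v (M *v x)) < x \<bullet> (matrix_inv P *v x)"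
proof -
  note inv = matrix_inv_mult_vec[OF pos_def_invertible[OF P]]
  have sym: "transpose P = P" using P by (simp add: pos_def_def)
  define y where "y = matrix_inv P *v x"
  define w where "w = matrix_inv P *v (M *v x)"
  define u where "u = transpose M *v w"
  have y: "P *v y = x" and w: "P *v w = M *v x" by (simp_all add: y_def w_def inv)
  show ?thesis
  proof (cases "w = 0")
    \<comment> \<open>\<open>decr\<close> says nothing at the zero vector, but here the left side of
      the claim vanishes.\<close>
    case True
    then show ?thesis
      using pos_def_matrix_inv[OF P] \<open>x \<noteq> 0\<close> by (simp add: w_def pos_def_def)
  next
    case False
    have "w \<bullet> (P *v w) = u \<bullet> (P *v y)" by (simp add: w y u_def transpose_inner)
    moreover have "0 \<le> (u - y) \<bullet> (P *v (u - y))" by (rule pos_def_nonneg[OF P])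
    then have "2 * (u \<bullet> (P *v y)) \<le> u \<bullet> (P *v u) + y \<bullet> (P *v y)"
      using symmetric_inner[OF sym, of y u]
      by (simp add: matrix_vector_mult_diff_distrib inner_diff_left inner_diff_right)
    moreover have "u \<bullet> (P *v u) < w \<bullet> (P *v w)" unfolding u_def by (rule decr[OF False])
    ultimately have "w \<bullet> (P *v w) < y \<bullet> (P *v y)" by linarith
    then show ?thesis by (simp add: w y inner_commute) (simp add: w_def y_def inner_commute)
  qed
qed

section \<open>Quadratic Lyapunov functions and stability\<close>

text \<open>The constant is the minimum of the form on the compact unit sphere, and homogeneity
  extends the bound to all vectors. Assuming positivity in place of \<open>pos_def\<close> lets it
  apply directly to \<open>S - transpose M ** S ** M\<close>.\<close>

lemma pos_def_coercive:
  fixes S :: "real^'n^'n"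
  assumes "\<And>x. x \<noteq> 0 \<Longrightarrow> x \<bullet> (S *v x) > 0"
  obtains c where "c > 0" "\<And>x. c * (norm x)\<^sup>2 \<le> x \<bullet> (S *v x)"
proof -
  have cont: "continuous_on (sphere 0 1) (\<lambda>x. x \<bullet> (S *v x))"
    by (intro continuous_intros)
  have "sphere (0::real^'n) 1 \<noteq> {}" by simp
  from continuous_attains_inf[OF compact_sphere this cont] obtain m where m: "m \<in> sphere 0 1"
    and min: "\<And>x. x \<in> sphere 0 1 \<Longrightarrow> m \<bullet> (S *v m) \<le> x \<bullet> (S *v x)" by blast
  show thesis
  proof (rule that[of "m \<bullet> (S *v m)"])
    show "m \<bullet> (S *v m) > 0"
    proof (rule assms)
      show "m \<noteq> 0" using m by auto
    qed
    fix x
    show "m \<bullet> (S *v m) * (norm x)\<^sup>2 \<le> x \<bullet> (S *v x)"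
    proof (cases "x = 0")
      case False
      define e where "e = x /\<^sub>R norm x"
      have "m \<bullet> (S *v m) \<le> e \<bullet> (S *v e)" using False by (intro min) (simp add: e_def)
      moreover have "x = norm x *\<^sub>R e" using False by (simp add: e_def)
      then have "x \<bullet> (S *v x) = (norm x)\<^sup>2 * (e \<bullet> (S *v e))"
        by (metis (no_types) inner_scaleR_left inner_scaleR_right matrix_vector_mult_scaleR
            mult.assoc power2_eq_square)
      ultimately show ?thesis by (metis mult.commute mult_right_mono zero_le_power2)
    qed simp
  qed
qed

text \<open>A complex eigenvector is split into its real and imaginary parts, so that the Hermitian
  form of \<open>S\<close> becomes \<open>V a + V b\<close>. Applying \<open>M\<close> scales this
  sum by the squared modulus of the eigenvalue, yet must decrease it strictly.\<close>

lemma schur_stable_if_lyapunov: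
  fixes S M :: "real^'n^'n"
  assumes S: "pos_def S"
    and decr: "\<And>x. x \<noteq> 0 \<Longrightarrow> (M *v x) \<bullet> (S *v (M *v x)) < x \<bullet> (S *v x)"
  shows "schur_stable M"
  unfolding schur_stable_def
proof (intro allI impI, elim conjE)
  fix l :: complex and v :: "complex^'n"
  assume "v \<noteq> 0" and eig: "(\<chi> i j. complex_of_real (M $ i $ j)) *v v = l *s v"
  define a b where "a = (\<chi> i. Re (v $ i))" and "b = (\<chi> i. Im (v $ i))"
  define V where "V x = x \<bullet> (S *v x)" for x
  have sym: "transpose S = S" using S by (simp add: pos_def_def)
  have comp: "(\<Sum>j\<in>UNIV. complex_of_real (M $ i $ j) * v $ j) = l * v $ i" for i
    using arg_cong[OF eig, of "\<lambda>w. w $ i"] by (simp add: matrix_vector_mult_def)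
  have Ma: "M *v a = Re l *\<^sub>R a - Im l *\<^sub>R b"
    using arg_cong[OF comp, of Re] by (simp add: vec_eq_iff matrix_vector_mult_def a_def b_def)
  have Mb: "M *v b = Im l *\<^sub>R a + Re l *\<^sub>R b"
    using arg_cong[OF comp, of Im] by (simp add: vec_eq_iff matrix_vector_mult_def a_def b_def)
  \<comment> \<open>The mixed terms of the two expansions cancel because \<open>S\<close> is
    symmetric.\<close>
  have eq: "V (M *v a) + V (M *v b) = (cmod l)\<^sup>2 * (V a + V b)"
    unfolding V_def Ma Mb cmod_power2 using symmetric_inner[OF sym, of b a]
    by (simp add: matrix_vector_mult_diff_distrib matrix_vector_right_distrib
        matrix_vector_mult_scaleR inner_diff_left inner_diff_right inner_add_left inner_add_right
        algebra_simps power2_eq_square)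
  have le: "V (M *v x) \<le> V x" for x
    using decr[of x] by (cases "x = 0") (auto simp: V_def)
  have "a \<noteq> 0 \<or> b \<noteq> 0"
    using \<open>v \<noteq> 0\<close> by (auto simp: vec_eq_iff a_def b_def complex_eq_iff)
  then have "V (M *v a) + V (M *v b) < V a + V b"
    using decr[of a] decr[of b] le[of a] le[of b] by (auto simp: V_def)
  moreover have "V a + V b \<ge> 0" using pos_def_nonneg[OF S] by (simp add: V_def)
  ultimately have "(cmod l)\<^sup>2 < 1"
    unfolding eq by (metis linorder_not_less mult_right_mono mult_1)
  then show "cmod l < 1" by (simp add: power_less_one_iff abs_square_less_1)
qed

text \<open>Lyapunov's indirect method: near \<open>x0\<close> the linearization error is so small
  that \<open>V\<close> still contracts by a fixed factor \<open>q\<close> per step, and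
  \<open>V\<close> is comparable to the squared norm.\<close>

lemma locally_exp_stable_if_lyapunov:
  fixes S M :: "real^'n^'n"
  assumes S: "pos_def S"
    and decr: "\<And>x. x \<noteq> 0 \<Longrightarrow> (M *v x) \<bullet> (S *v (M *v x)) < x \<bullet> (S *v x)"
    and fixpt: "g x0 = x0"
    and deriv: "(g has_derivative (*v) M) (at x0)"
  shows "locally_exp_stable_equilibrium g x0"
proof -
  define V where "V x = x \<bullet> (S *v x)" for x
  have sym: "transpose S = S" using S by (simp add: pos_def_def)
  obtain c0 where c0: "c0 > 0" "\<And>x. c0 * (norm x)\<^sup>2 \<le> V x"
    using pos_def_coercive[of S] S unfolding V_def pos_def_def by metis
  have diff: "x \<bullet> ((S - transpose M ** S ** M) *v x) = V x - V (M *v x)" for x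
    by (simp add: V_def matrix_vector_mult_diff_rdistrib inner_diff_right transpose_inner
        matrix_vector_mul_assoc[symmetric])
  obtain c where c: "c > 0" "\<And>x. c * (norm x)\<^sup>2 \<le> V x - V (M *v x)"
    using pos_def_coercive[of "S - transpose M ** S ** M"] decr
    unfolding diff V_def by (metis diff_gt_0_iff_gt)
  obtain C0 where C0: "\<And>x. norm (S *v x) \<le> norm x * C0" "C0 > 0"
    using bounded_linear.pos_bounded[OF matrix_vector_mul_bounded_linear] by blast
  obtain L where L: "\<And>x. norm (M *v x) \<le> norm x * L" "L > 0"
    using bounded_linear.pos_bounded[OF matrix_vector_mul_bounded_linear] by blast
  \<comment> \<open>Adding \<open>c\<close> to the operator bound forces \<open>c < C\<close>, which
    makes the factor \<open>q\<close> below positive.\<close>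
  define C where "C = C0 + c"
  have C: "C > 0" "c < C" using C0 c by (simp_all add: C_def)
  have S_le: "norm (S *v x) \<le> C * norm x" for x
    using C0(1)[of x] c(1) by (simp add: C_def algebra_simps add_increasing2)
  have inner_le: "x \<bullet> (S *v y) \<le> C * norm x * norm y" for x y
  proof -
    have "x \<bullet> (S *v y) \<le> norm x * norm (S *v y)" by (rule norm_cauchy_schwarz)
    also have "\<dots> \<le> norm x * (C * norm y)" by (intro mult_left_mono S_le) simp
    finally show ?thesis by (simp add: mult_ac)
  qed
  have V_le: "V x \<le> C * (norm x)\<^sup>2" for x
    using inner_le[of x x] by (simp add: V_def power2_eq_square mult_ac)
  \<comment> \<open>The second entry lets the error terms consume at most half of the decrease
    \<open>c\<close>; the cap 1 bounds the quadratic error term by a linear one in \<eta>.\<close>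
  define \<eta> where "\<eta> = min 1 (c / (2 * (2 * L * C + C)))"
  have D: "2 * L * C + C > 0" using C L by (simp add: add_pos_pos)
  have \<eta>: "\<eta> > 0" "\<eta> \<le> 1" "(2 * L * C + C) * \<eta> \<le> c / 2"
  proof -
    show "\<eta> > 0" "\<eta> \<le> 1" using c D by (simp_all add: \<eta>_def)
    have "(2 * L * C + C) * \<eta> \<le> (2 * L * C + C) * (c / (2 * (2 * L * C + C)))"
      using D by (intro mult_left_mono) (auto simp: \<eta>_def)
    also have "\<dots> = c / 2" using D by (simp add: field_simps)
    finally show "(2 * L * C + C) * \<eta> \<le> c / 2" .
  qed
  obtain \<delta> where \<delta>: "\<delta> > 0"
    and rem: "\<And>x. norm (x - x0) < \<delta> \<Longrightarrow> norm (g x - g x0 - M *v (x - x0)) \<le> \<eta> * norm (x - x0)"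
    using deriv \<eta>(1) unfolding has_derivative_at_alt by blast
  \<comment> \<open>The surviving decrease is \<open>c / 2\<close> times the squared norm, which is
    at least \<open>c / (2 * C)\<close> times \<open>V\<close>.\<close>
  define q where "q = 1 - c / (2 * C)"
  have q: "0 < q" "q < 1" using C c by (simp_all add: q_def field_simps)
  have step: "V (g x - x0) \<le> q * V (x - x0)" if "norm (x - x0) < \<delta>" for x
  proof -
    define h where "h = x - x0"
    define r where "r = g x - x0 - M *v h"
    have r: "norm r \<le> \<eta> * norm h" using rem[OF that] by (simp add: r_def h_def fixpt)
    have "V (g x - x0) = V (M *v h + r)" by (simp add: r_def)
    also have "\<dots> = V (M *v h) + 2 * ((M *v h) \<bullet> (S *v r)) + V r"
      using symmetric_inner[OF sym, of r "M *v h"]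
      by (simp add: V_def matrix_vector_right_distrib inner_add_left inner_add_right)
    also have "\<dots> \<le> (V h - c * (norm h)\<^sup>2) + 2 * (L * C * \<eta> * (norm h)\<^sup>2) + C * \<eta> * (norm h)\<^sup>2"
    proof (intro add_mono mult_left_mono)
      show "V (M *v h) \<le> V h - c * (norm h)\<^sup>2" using c(2)[of h] by simp
      have "(M *v h) \<bullet> (S *v r) \<le> C * norm (M *v h) * norm r" by (rule inner_le)
      also have "\<dots> \<le> C * (norm h * L) * (\<eta> * norm h)"
        using C L r by (intro mult_mono) auto
      finally show "(M *v h) \<bullet> (S *v r) \<le> L * C * \<eta> * (norm h)\<^sup>2"
        by (simp add: power2_eq_square mult_ac)
      have "V r \<le> C * (norm r)\<^sup>2" by (rule V_le)
      also have "\<dots> \<le> C * (\<eta> * norm h)\<^sup>2" using C r by (intro mult_left_mono power_mono) auto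
      also have "\<dots> = C * (norm h)\<^sup>2 * (\<eta> * \<eta>)" by (simp add: power2_eq_square mult_ac)
      also have "\<dots> \<le> C * (norm h)\<^sup>2 * (\<eta> * 1)" using C \<eta> by (intro mult_left_mono) auto
      finally show "V r \<le> C * \<eta> * (norm h)\<^sup>2" by (simp add: mult_ac)
    qed simp
    also have "\<dots> = V h - c * (norm h)\<^sup>2 + (2 * L * C + C) * \<eta> * (norm h)\<^sup>2"
      by (simp add: algebra_simps)
    also have "\<dots> \<le> V h - c * (norm h)\<^sup>2 + c / 2 * (norm h)\<^sup>2"
      using \<eta>(3) by (intro add_left_mono mult_right_mono) auto
    also have "\<dots> = V h - c / (2 * C) * (C * (norm h)\<^sup>2)" using C by (simp add: field_simps)
    also have "\<dots> \<le> V h - c / (2 * C) * V h"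
      using V_le[of h] C c by (intro diff_left_mono mult_left_mono) auto
    also have "\<dots> = q * V h" by (simp add: q_def algebra_simps)
    finally show ?thesis by (simp add: h_def)
  qed
  \<comment> \<open>The sublevel set of \<open>V\<close> at this height lies in the ball where
    \<open>step\<close> applies, and \<open>q < 1\<close> keeps the orbit inside the sublevel set.
    The ball itself need not be invariant.\<close>
  have small: "norm x < \<delta>" if "V x < c0 * \<delta>\<^sup>2" for x
  proof -
    have "c0 * (norm x)\<^sup>2 < c0 * \<delta>\<^sup>2" using c0(2)[of x] that by linarith
    then have "(norm x)\<^sup>2 < \<delta>\<^sup>2" using c0(1) by simp
    then show ?thesis using \<delta> by (auto intro: power2_less_imp_less)
  qed
  have V_nonneg: "V x \<ge> 0" for x unfolding V_def by (rule pos_def_nonneg[OF S])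
  have iter: "V ((g ^^ k) x - x0) \<le> q ^ k * V (x - x0)" if x: "V (x - x0) < c0 * \<delta>\<^sup>2" for x k
  proof (induction k)
    case (Suc k)
    have "q ^ k * V (x - x0) \<le> 1 * V (x - x0)"
      using q V_nonneg by (intro mult_right_mono) (auto simp: power_le_one)
    with Suc x have "V ((g ^^ k) x - x0) < c0 * \<delta>\<^sup>2" by linarith
    from step[OF small[OF this]] have "V ((g ^^ Suc k) x - x0) \<le> q * V ((g ^^ k) x - x0)" by simp
    also have "\<dots> \<le> q * (q ^ k * V (x - x0))" using q Suc by (intro mult_left_mono) auto
    finally show ?case by (simp add: mult_ac)
  qed simp
  \<comment> \<open>A ball of this radius fits into the sublevel set. Since \<open>V\<close> is
    quadratic, the rate for the norm is \<open>sqrt q\<close>, and \<open>sqrt (C / c0)\<close>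
    comes from comparing \<open>V\<close> with the squared norm on both sides.\<close>
  have "norm ((g ^^ k) x - x0) \<le> sqrt (C / c0) * sqrt q ^ k * norm (x - x0)"
    if "norm (x - x0) < \<delta> * sqrt (c0 / C)" for x k
  proof -
    have "(norm (x - x0))\<^sup>2 < (\<delta> * sqrt (c0 / C))\<^sup>2"
      using that by (intro power_strict_mono) auto
    also have "\<dots> = c0 * \<delta>\<^sup>2 / C" using c0 C by (simp add: power_mult_distrib)
    finally have "C * (norm (x - x0))\<^sup>2 < c0 * \<delta>\<^sup>2" using C by (simp add: field_simps)
    with V_le[of "x - x0"] have "V (x - x0) < c0 * \<delta>\<^sup>2" by linarith
    then have "c0 * (norm ((g ^^ k) x - x0))\<^sup>2 \<le> q ^ k * V (x - x0)"
      using iter c0(2) order_trans by blast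
    also have "\<dots> \<le> q ^ k * (C * (norm (x - x0))\<^sup>2)" using q V_le by (intro mult_left_mono) auto
    finally have "(norm ((g ^^ k) x - x0))\<^sup>2 \<le> C / c0 * q ^ k * (norm (x - x0))\<^sup>2"
      using c0(1) by (simp add: field_simps)
    then have "sqrt ((norm ((g ^^ k) x - x0))\<^sup>2) \<le> sqrt (C / c0 * q ^ k * (norm (x - x0))\<^sup>2)"
      by (rule real_sqrt_le_mono)
    then show ?thesis unfolding real_sqrt_mult real_sqrt_power by simp
  qed
  moreover have "\<delta> * sqrt (c0 / C) > 0" "sqrt (C / c0) > 0" "0 < sqrt q" "sqrt q < 1"
    using \<delta> c0 C q by simp_all
  ultimately show ?thesis unfolding locally_exp_stable_equilibrium_def using fixpt by blast
qed

section \<open>Linearization and perturbation estimate\<close>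

text \<open>The partial Jacobians are the restrictions of the total derivative \<open>F\<close> to
  the two coordinate subspaces, so by linearity they determine \<open>F (h, K *v h)\<close>, the
  derivative given by the chain rule.\<close>

lemma closed_loop_has_derivative:
  fixes f :: "(real^'n) \<times> (real^'m) \<Rightarrow> real^'n" and K :: "real^'n^'m"
  assumes "f differentiable (at (x0, u0))"
  shows "((\<lambda>x. f (x, u0 + K *v (x - x0))) has_derivative
    (*v) (jacobian (\<lambda>x. f (x, u0)) (at x0) + jacobian (\<lambda>u. f (x0, u)) (at u0) ** K)) (at x0)"
proof -
  from assms obtain F where F: "(f has_derivative F) (at (x0, u0))"
    by (auto simp: differentiable_def)
  have Fx: "((\<lambda>x. f (x, u0)) has_derivative (\<lambda>h. F (h, 0))) (at x0)"
    by (rule has_derivative_compose[where f = "\<lambda>x. (x, u0)" and g = f])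
      (auto intro!: derivative_eq_intros F)
  have Fu: "((\<lambda>u. f (x0, u)) has_derivative (\<lambda>h. F (0, h))) (at u0)"
    by (rule has_derivative_compose[where f = "\<lambda>u. (x0, u)" and g = f])
      (auto intro!: derivative_eq_intros F)
  have A: "F (h, 0) = jacobian (\<lambda>x. f (x, u0)) (at x0) *v h" for h
    using Fx jacobian_works has_derivative_unique differentiable_def by metis
  have B: "F (0, h) = jacobian (\<lambda>u. f (x0, u)) (at u0) *v h" for h
    using Fu jacobian_works has_derivative_unique differentiable_def by metis
  have "linear F" using F has_derivative_linear by blast
  then have "F (h, k) = F (h, 0) + F (0, k)" for h k
    using linear_add[of F "(h, 0)" "(0, k)"] by simp
  moreover have "((\<lambda>x. f (x, u0 + K *v (x - x0))) has_derivative (\<lambda>h. F (h, K *v h))) (at x0)"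
    by (rule has_derivative_compose[where f = "\<lambda>x. (x, u0 + K *v (x - x0))" and g = f])
      (auto intro!: derivative_eq_intros F
        bounded_linear.has_derivative[OF matrix_vector_mul_bounded_linear])
  moreover have "(\<lambda>h. jacobian (\<lambda>x. f (x, u0)) (at x0) *v h
      + jacobian (\<lambda>u. f (x0, u)) (at u0) *v (K *v h)) =
    (*v) (jacobian (\<lambda>x. f (x, u0)) (at x0) + jacobian (\<lambda>u. f (x0, u)) (at u0) ** K)"
    by (simp add: fun_eq_iff matrix_vector_mult_add_rdistrib matrix_vector_mul_assoc)
  ultimately show ?thesis by (simp add: A B)
qed

text \<open>Young's inequality with parameter \<open>\<alpha> / 2\<close> is what produces the bound
  \<open>\<alpha>\<^sup>2 / (4 + 2 * \<alpha>)\<close>.\<close>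
lemma perturbed_quadratic_form_le:
  fixes P :: "real^'n^'n" and a b :: "real^'n"
  assumes P: "pos_def P" and "\<alpha> > 0" and \<gamma>: "\<gamma> < \<alpha>\<^sup>2 / (4 + 2 * \<alpha>)"
    and na: "a \<bullet> (P *v a) \<le> s" and nb: "b \<bullet> (P *v b) \<le> \<gamma> * s"
  shows "(a - b) \<bullet> (P *v (a - b)) \<le> a \<bullet> (P *v a) + \<alpha> * s"
proof -
  have sym: "transpose P = P" using P by (simp add: pos_def_def)
  define aa ab bb where "aa = a \<bullet> (P *v a)" and "ab = a \<bullet> (P *v b)" and "bb = b \<bullet> (P *v b)"
  have s: "0 \<le> s" using na pos_def_nonneg[OF P, of a] by linarith
  have "0 \<le> ((\<alpha> / 2) *\<^sub>R a + b) \<bullet> (P *v ((\<alpha> / 2) *\<^sub>R a + b))" by (rule pos_def_nonneg[OF P])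
  also have "\<dots> = (\<alpha> / 2)\<^sup>2 * aa + \<alpha> * ab + bb"
    using symmetric_inner[OF sym, of b a]
    by (simp add: matrix_vector_right_distrib matrix_vector_mult_scaleR inner_add_left
        inner_add_right aa_def ab_def bb_def power2_eq_square algebra_simps)
  finally have "- \<alpha> * ab \<le> (\<alpha> / 2)\<^sup>2 * s + bb"
    using mult_left_mono[OF na, of "(\<alpha> / 2)\<^sup>2"] by (simp add: aa_def)
  \<comment> \<open>After multiplication by \<alpha> the available budget is
    \<open>\<alpha>\<^sup>2 * s\<close>. The cross term takes half of it; the condition on \<gamma>
    says exactly that the \<open>bb\<close> term fits strictly into the other half when
    \<open>s\<close> is positive.\<close>
  then have "\<alpha> * (- 2 * ab + bb) \<le> \<alpha>\<^sup>2 / 2 * s + (2 + \<alpha>) * bb"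
    by (simp add: algebra_simps power2_eq_square)
  also have "(2 + \<alpha>) * bb \<le> (2 + \<alpha>) * (\<gamma> * s)"
    using nb \<open>\<alpha> > 0\<close> by (intro mult_left_mono) (auto simp: bb_def)
  also have "\<dots> = (2 + \<alpha>) * \<gamma> * s" by simp
  also have "\<dots> \<le> \<alpha>\<^sup>2 / 2 * s"
  proof (intro mult_right_mono s)
    have "\<gamma> * (4 + 2 * \<alpha>) < \<alpha>\<^sup>2" using \<gamma> \<open>\<alpha> > 0\<close> by (simp add: field_simps)
    then show "(2 + \<alpha>) * \<gamma> \<le> \<alpha>\<^sup>2 / 2" by (simp add: algebra_simps)
  qed
  finally have "\<alpha> * (- 2 * ab + bb) \<le> \<alpha> * (\<alpha> * s)" by (simp add: power2_eq_square)
  then have "- 2 * ab + bb \<le> \<alpha> * s" using \<open>\<alpha> > 0\<close> by simp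
  moreover have "(a - b) \<bullet> (P *v (a - b)) = aa - 2 * ab + bb"
    using symmetric_inner[OF sym, of b a]
    by (simp add: matrix_vector_mult_diff_distrib inner_diff_left inner_diff_right
        aa_def ab_def bb_def)
  ultimately show ?thesis by (simp add: aa_def)
qed

section \<open>Stability of the data-driven closed loop\<close>

theorem theorem6:
  fixes f :: "(real^'n) \<times> (real^'m) \<Rightarrow> real^'n"
    and xbar :: "real^'n" and ubar :: "real^'m"
    and xd dx d :: "nat \<Rightarrow> real^'n" and ud du :: "nat \<Rightarrow> real^'m"
    and A :: "real^'n^'n" and B :: "real^'m^'n"
    and X0 X1 D0 :: "real^('t::{finite,linorder})^'n" and U0 :: "real^('t::{finite,linorder})^'m"
    and \<gamma> \<alpha> :: real and Q :: "real^'n^('t::{finite,linorder})" and K :: "real^'n^'m"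
  assumes smooth: "smooth f"
    and equilibrium: "xbar = f (xbar, ubar)"
    and data: "\<And>k. k < CARD('t) \<Longrightarrow> xd (Suc k) = f (xd k, ud k)"
    and A: "A = jacobian (\<lambda>x. f (x, ubar)) (at xbar)"
    and B: "B = jacobian (\<lambda>u. f (xbar, u)) (at ubar)"
    and dx: "\<And>k. dx k = xd k - xbar"
    and du: "\<And>k. du k = ud k - ubar"
    and d: "\<And>k. d k = dx (Suc k) - A *v dx k - B *v du k"
    and X0: "X0 = data_matrix 0 dx"
    and X1: "X1 = data_matrix 1 dx"
    and U0: "U0 = data_matrix 0 du"
    and D0: "D0 = data_matrix 0 d"
    and rank_UX: "full_row_rank (vstack U0 X0)"
    and rank_X1: "full_row_rank X1"
    and gamma_pos: "\<gamma> > 0"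
    and remainder: "loewner_le (D0 ** transpose D0) (\<gamma> *\<^sub>R (X1 ** transpose X1))"
    and alpha_pos: "\<alpha> > 0"
    and lmi1: "pos_def (block_mat (X0 ** Q - \<alpha> *\<^sub>R (X1 ** transpose X1)) (X1 ** Q)
                                   (transpose Q ** transpose X1)           (X0 ** Q))"
    and lmi2: "pos_def (block_mat (mat 1)       Q
                                   (transpose Q) (X0 ** Q))"
    and gamma_alpha: "\<gamma> < \<alpha>\<^sup>2 / (4 + 2 * \<alpha>)"
    and K: "K = U0 ** Q ** matrix_inv (X0 ** Q)"
  shows "schur_stable (A + B ** K) \<and> locally_stabilizes f xbar ubar K"
proof -
  define P where "P = X0 ** Q"
  define M where "M = A + B ** K"
  have P: "pos_def P" using pos_def_block_lower_right[OF lmi2] by (simp add: P_def)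
  have sym: "transpose P = P" using P by (simp add: pos_def_def)
  note inv = pos_def_invertible[OF P]
  \<comment> \<open>Column by column this is the definition of the remainder \<open>d\<close>,
    rearranged; the shift by one in \<open>X1\<close> supplies \<open>dx (Suc k)\<close>.\<close>
  have X1_eq: "X1 - D0 = A ** X0 + B ** U0"
  proof (unfold vec_eq_iff, intro allI)
    fix i j
    define k where "k = time_index (j::'t)"
    have "(X1 - D0) $ i $ j = (A *v dx k + B *v du k) $ i"
      by (simp add: X1 D0 data_matrix_def d k_def)
    also have "\<dots> = (A ** X0 + B ** U0) $ i $ j"
      by (simp add: X0 U0 data_matrix_def matrix_matrix_mult_def matrix_vector_mult_def k_def)
    finally show "(X1 - D0) $ i $ j = (A ** X0 + B ** U0) $ i $ j" .
  qed
  \<comment> \<open>Multiply \<open>X1_eq\<close> on the right by \<open>Q ** matrix_inv P\<close>: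
    this turns \<open>X0\<close> into the identity and \<open>U0\<close> into \<open>K\<close>,
    which removes the unknown \<open>A\<close> and \<open>B\<close>.\<close>
  have M_eq: "M = (X1 - D0) ** Q ** matrix_inv P"
  proof -
    have "(X1 - D0) ** Q ** matrix_inv P = A ** (P ** matrix_inv P) + B ** (U0 ** Q ** matrix_inv P)"
      unfolding X1_eq P_def by (simp add: matrix_add_rdistrib matrix_mul_assoc)
    also have "\<dots> = M" by (simp add: M_def K P_def[symmetric] matrix_inv_left_right(2)[OF inv])
    finally show ?thesis ..
  qed
  have decr: "(transpose M *v v) \<bullet> (P *v (transpose M *v v)) < v \<bullet> (P *v v)" if "v \<noteq> 0" for v
  proof -
    define a b where "a = transpose X1 *v v" and "b = transpose D0 *v v"
    define R where "R = matrix_inv P"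
    have R: "pos_def R" unfolding R_def by (rule pos_def_matrix_inv[OF P])
    \<comment> \<open>The Schur complement of the second matrix inequality. It bounds the forms at
      both \<open>a\<close> and \<open>b\<close> by Euclidean norms, where the remainder bound can
      be used.\<close>
    have W_le: "(transpose Q *v z) \<bullet> (R *v (transpose Q *v z)) \<le> z \<bullet> z" for z
      using pos_def_schur_complement[OF lmi2, of z] by (cases "z = 0") (auto simp: R_def P_def)
    have "transpose M *v v = R *v (transpose Q *v (a - b))"
      using R by (simp add: M_eq a_def b_def matrix_transpose_mul matrix_vector_mul_assoc[symmetric]
          R_def[symmetric] pos_def_def transpose_diff matrix_vector_mult_diff_rdistrib)
    then have "(transpose M *v v) \<bullet> (P *v (transpose M *v v)) =
        (transpose Q *v a - transpose Q *v b) \<bullet> (R *v (transpose Q *v a - transpose Q *v b))"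
      by (simp add: R_def matrix_inv_mult_vec(1)[OF inv] inner_commute
          matrix_vector_mult_diff_distrib)
    also have "\<dots> \<le> (transpose Q *v a) \<bullet> (R *v (transpose Q *v a)) + \<alpha> * (a \<bullet> a)"
    \<comment> \<open>Here \<open>s\<close> is \<open>a \<bullet> a\<close>, the form of
      \<open>X1 ** transpose X1\<close> at \<open>v\<close>; the remainder bound evaluated at
      \<open>v\<close> gives \<open>b \<bullet> b \<le> \<gamma> * (a \<bullet> a)\<close>.\<close>
    proof (rule perturbed_quadratic_form_le[OF R alpha_pos gamma_alpha W_le])
      have "0 \<le> v \<bullet> ((\<gamma> *\<^sub>R (X1 ** transpose X1) - D0 ** transpose D0) *v v)"
        using remainder by (simp add: loewner_le_def pos_semidef_def)
      also have "\<dots> = \<gamma> * (a \<bullet> a) - b \<bullet> b"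
        by (simp add: matrix_vector_mult_diff_rdistrib scaleR_matrix_vector_assoc[symmetric]
            matrix_vector_mul_assoc[symmetric] inner_diff_right transpose_inner a_def b_def)
      finally show "(transpose Q *v b) \<bullet> (R *v (transpose Q *v b)) \<le> \<gamma> * (a \<bullet> a)"
        using W_le[of b] by linarith
    qed
    \<comment> \<open>The Schur complement of the first matrix inequality: its upper left block
      carries the term in \<alpha> that pays for the perturbation, and it makes the bound
      strict.\<close>
    also have "\<dots> < v \<bullet> (P *v v)"
      using pos_def_schur_complement[OF lmi1[folded matrix_transpose_mul P_def] that]
      by (simp add: matrix_transpose_mul matrix_vector_mul_assoc[symmetric]
          matrix_vector_mult_diff_rdistrib scaleR_matrix_vector_assoc[symmetric]
          inner_diff_right transpose_inner[of v X1] a_def R_def)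
    finally show ?thesis .
  qed
  \<comment> \<open>Both conclusions use the same Lyapunov matrix \<open>matrix_inv P\<close>: on
    \<open>M\<close> itself for the eigenvalues, and on the nonlinear closed loop with derivative
    \<open>M\<close>.\<close>
  note lyap = pos_def_matrix_inv[OF P] lyapunov_dual[OF P decr]
  have "cont_differentiable (Suc 0) f" using smooth unfolding smooth_def by blast
  then have "f differentiable (at (xbar, ubar))" by simp
  then have "((\<lambda>x. f (x, ubar + K *v (x - xbar))) has_derivative (*v) M) (at xbar)"
    unfolding M_def A B by (rule closed_loop_has_derivative)
  then have "locally_stabilizes f xbar ubar K"
    unfolding locally_stabilizes_def using equilibrium
    by (intro locally_exp_stable_if_lyapunov[OF lyap]) auto
  moreover have "schur_stable M" by (rule schur_stable_if_lyapunov[OF lyap])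
  ultimately show ?thesis by (simp add: M_def)
qed

end
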